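(* There does not exist any deterministic algorithm that solves exploration with partial termination of 1-interval connected anonymous rings of unknown size $n$ by two agents in the fully synchronous model ($\mathcal{FSYNC}$). This holds even if the two agents have distinct IDs and common chirality.
   Context: Ring: the nodes $v_0,\dots,v_{n-1}$ (indices modulo $n$) form a cycle; $v_i$ is linked to $v_{i-1}$ and $v_{i+1}$ via distinctly labelled ports $q_{i-}$ and $q_{i+}$ (labels need not be globally consistent). Time proceeds in rounds; in each round at most one edge, chosen by an adversary, is missing (1-interval connected ring). The ring is anonymous if nodes have no distinguishable identifiers. 'Unknown size' means the algorithm has no information on $n$ (not even an upper bound) and must work for every $n$. Agents: each has memory and computational power; all execute the same deterministic protocol (with distinct IDs, the behaviour may depend on the agent's ID). They start at arbitrary, not necessarily distinct, nodes, cannot communicate explicitly and cannot mark nodes. Each agent $a_j$ has a consistent private orientation, i.e. a function $\lambda_j$ designating each port left or right with $\lambda_j(q_{i-})=\lambda_j(q_{k-})$ for all $i,k$. Chirality: all agents have the same orientation and are aware of it. Round: each active agent performs Look (it sees its own position within its node, i.e. whether it is on a port and which one, and the positions of the other agents at that node), Compute (from this snapshot and its memory it determines a direction in $\{left,right,nil\}$; if $nil$ it becomes inactive; otherwise it tries to access the corresponding port if not already there), and Move. Ports are accessed in mutual exclusion: an occupied port cannot be gained, and if several agents try the same port exactly one succeeds; an agent that fails sets $moved=false$ and becomes inactive. An agent on a port after computing moves to the other endpoint if the edge is present in this round (setting $moved=true$), and otherwise stays on the port (setting $moved=false$); in either case the port is denied to other agents in that round. Two agents crossing the same edge in opposite directions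 in the same round might not detect each other. $\mathcal{FSYNC}$: all agents are active in every round. Exploration is solved if within finite time every node is visited by at least one agent, in every execution (all initial positions and all adversary choices). It is with partial termination if moreover at least one agent enters, within finite time, a terminal state and no longer moves; a terminal state may be entered only after the ring has been explored. *)

theory Defs
  imports Main
begin

text \<open>
  Nodes of a ring of size \<open>n\<close> are the numbers below \<open>n\<close>.  Edge \<open>i\<close> joins node \<open>i\<close> and node
  \<open>(i + 1) mod n\<close>.  The port \<open>Plus\<close> of node \<open>i\<close> (the port \<open>q\<^sub>i\<^sub>+\<close>) leads over edge \<open>i\<close>, the port
  \<open>Minus\<close> (the port \<open>q\<^sub>i\<^sub>-\<close>) over edge \<open>(i - 1) mod n\<close>.  These names belong to the model only;
  agents refer to ports by their private directions.
\<close>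

datatype agent = A | B
datatype side = Minus | Plus
datatype dir = Left | Right

fun other :: "agent \<Rightarrow> agent" where
  "other A = B"
| "other B = A"

fun neighbour :: "nat \<Rightarrow> nat \<Rightarrow> side \<Rightarrow> nat" where
  "neighbour n i Plus = (i + 1) mod n"
| "neighbour n i Minus = (i + n - 1) mod n"

fun edge_of :: "nat \<Rightarrow> nat \<Rightarrow> side \<Rightarrow> nat" where
  "edge_of n i Plus = i"
| "edge_of n i Minus = (i + n - 1) mod n"

datatype 'p place = Interior | Port 'p

text \<open>
  What an agent sees, expressed in its own orientation: its place in the node, the place of the
  other agent if that agent is at the same node, and the local labels of the two ports.
\<close>

record snapshot =
  own_place :: "dir place"
  other_place :: "dir place option"
  port_label :: "dir \<Rightarrow> nat"

text \<open>
  A deterministic protocol with memory type \<open>'s\<close>.  Every ingredient may depend on the identifier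
  of the executing agent; agents without identifiers are modelled by giving both the same one.
  The Boolean argument of \<open>compute\<close> is the flag \<open>moved\<close>; \<open>None\<close> stands for the direction nil.
  No effectivity or memory bound is imposed.
\<close>

record 's protocol =
  init_mem :: "nat \<Rightarrow> 's"
  compute :: "nat \<Rightarrow> 's \<Rightarrow> bool \<Rightarrow> snapshot \<Rightarrow> 's \<times> dir option"
  terminal :: "nat \<Rightarrow> 's \<Rightarrow> bool"

record 's agent_state =
  node :: nat
  place :: "side place"
  mem :: 's
  moved :: bool

type_synonym 's config = "agent \<Rightarrow> 's agent_state"

text \<open>
  Everything the protocol does not control: the ring with its local port labels, the starting nodes,
  the private orientations \<open>\<lambda>\<^sub>j\<close>, the edge missing in each round (if any), and the agent that wins a
  port contested in that round.  As protocols are deterministic, quantifying over these sequences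
  also covers adaptive adversaries.
\<close>

record scenario =
  ring_size :: nat
  label_of :: "nat \<Rightarrow> side \<Rightarrow> nat"
  start :: "agent \<Rightarrow> nat"
  orient :: "agent \<Rightarrow> nat \<Rightarrow> side \<Rightarrow> dir"
  missing :: "nat \<Rightarrow> nat option"
  winner :: "nat \<Rightarrow> agent"

definition valid_scenario :: "scenario \<Rightarrow> bool" where
  "valid_scenario E \<longleftrightarrow>
     ring_size E \<ge> 3 \<and>
     (\<forall>i<ring_size E. label_of E i Minus \<noteq> label_of E i Plus) \<and>
     (\<forall>j. start E j < ring_size E) \<and>
     (\<forall>j. \<forall>i<ring_size E. orient E j i Minus \<noteq> orient E j i Plus) \<and>
     (\<forall>j. \<forall>i<ring_size E. \<forall>k<ring_size E. \<forall>s. orient E j i s = orient E j k s) \<and>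
     (\<forall>t e. missing E t = Some e \<longrightarrow> e < ring_size E)"

definition common_chirality :: "scenario \<Rightarrow> bool" where
  "common_chirality E \<longleftrightarrow> (\<forall>i<ring_size E. \<forall>s. orient E A i s = orient E B i s)"

definition side_of :: "scenario \<Rightarrow> agent \<Rightarrow> nat \<Rightarrow> dir \<Rightarrow> side" where
  "side_of E j i d = (if orient E j i Minus = d then Minus else Plus)"

definition look :: "scenario \<Rightarrow> 's config \<Rightarrow> agent \<Rightarrow> snapshot" where
  "look E c j =
     (let i = node (c j); k = other j in
      \<lparr> own_place = map_place (orient E j i) (place (c j)),
        other_place =
          (if node (c k) = i then Some (map_place (orient E j i) (place (c k))) else None),
        port_label = (\<lambda>d. label_of E i (side_of E j i d)) \<rparr>)"

text \<open>
  An agent in a terminal state changes neither its memory nor its position, and an agent entering a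
  terminal state does not move any more, already in the round in which it enters it.
\<close>

definition decide ::
  "'s protocol \<Rightarrow> (agent \<Rightarrow> nat) \<Rightarrow> scenario \<Rightarrow> 's config \<Rightarrow> agent \<Rightarrow> 's \<times> dir option" where
  "decide P ids E c j =
     (if terminal P (ids j) (mem (c j)) then (mem (c j), None)
      else let (s, d) = compute P (ids j) (mem (c j)) (moved (c j)) (look E c j)
           in (s, if terminal P (ids j) s then None else d))"

definition wants ::
  "'s protocol \<Rightarrow> (agent \<Rightarrow> nat) \<Rightarrow> scenario \<Rightarrow> 's config \<Rightarrow> agent \<Rightarrow> side option" where
  "wants P ids E c j = map_option (side_of E j (node (c j))) (snd (decide P ids E c j))"

text \<open>
  Whether agent \<open>j\<close>, wanting port \<open>p\<close> of its node in round \<open>t\<close>, is on that port after computing.  A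
  port occupied at the beginning of a round cannot be gained in that round, even if its occupant
  simultaneously asks for the opposite port.
\<close>

definition gets_port ::
  "'s protocol \<Rightarrow> (agent \<Rightarrow> nat) \<Rightarrow> scenario \<Rightarrow> nat \<Rightarrow> 's config \<Rightarrow> agent \<Rightarrow> side \<Rightarrow> bool" where
  "gets_port P ids E t c j p \<longleftrightarrow>
     (let k = other j in
      place (c j) = Port p \<or>
      node (c k) \<noteq> node (c j) \<or>
      (place (c k) \<noteq> Port p \<and> (wants P ids E c k = Some p \<longrightarrow> winner E t = j)))"

text \<open>
  An agent crossing an edge arrives in the interior of the next node.  An agent choosing nil, and an
  agent failing to gain a port, keep their place (possibly a port held before).
\<close>

definition step ::
  "'s protocol \<Rightarrow> (agent \<Rightarrow> nat) \<Rightarrow> scenario \<Rightarrow> nat \<Rightarrow> 's config \<Rightarrow> 's config" where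
  "step P ids E t c = (\<lambda>j.
     let i = node (c j); s = fst (decide P ids E c j) in
     case wants P ids E c j of
       None \<Rightarrow> (c j)\<lparr>mem := s\<rparr>
     | Some p \<Rightarrow>
         if \<not> gets_port P ids E t c j p then (c j)\<lparr>mem := s, moved := False\<rparr>
         else if missing E t = Some (edge_of (ring_size E) i p) then
           \<lparr>node = i, place = Port p, mem = s, moved = False\<rparr>
         else
           \<lparr>node = neighbour (ring_size E) i p, place = Interior, mem = s, moved = True\<rparr>)"

text \<open>
  The configuration at the beginning of round \<open>t\<close> under full synchrony.
\<close>

primrec run :: "'s protocol \<Rightarrow> (agent \<Rightarrow> nat) \<Rightarrow> scenario \<Rightarrow> nat \<Rightarrow> 's config" where
  "run P ids E 0 =
     (\<lambda>j. \<lparr>node = start E j, place = Interior, mem = init_mem P (ids j), moved = False\<rparr>)"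
| "run P ids E (Suc t) = step P ids E t (run P ids E t)"

definition explored_by :: "'s protocol \<Rightarrow> (agent \<Rightarrow> nat) \<Rightarrow> scenario \<Rightarrow> nat \<Rightarrow> bool" where
  "explored_by P ids E T \<longleftrightarrow> (\<forall>v<ring_size E. \<exists>t\<le>T. \<exists>j. node (run P ids E t j) = v)"

definition terminated_at :: "'s protocol \<Rightarrow> (agent \<Rightarrow> nat) \<Rightarrow> scenario \<Rightarrow> nat \<Rightarrow> agent \<Rightarrow> bool" where
  "terminated_at P ids E t j \<longleftrightarrow> terminal P (ids j) (mem (run P ids E t j))"

text \<open>
  The ring size is part of the scenario and hidden from the protocol, so one protocol has to work
  for all sizes.  Without chirality, all pairs of orientations are admitted.
\<close>

definition solves_with_partial_termination ::
  "bool \<Rightarrow> (agent \<Rightarrow> nat) \<Rightarrow> 's protocol \<Rightarrow> bool" where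
  "solves_with_partial_termination chirality ids P \<longleftrightarrow>
     (\<forall>E. valid_scenario E \<and> (chirality \<longrightarrow> common_chirality E) \<longrightarrow>
        (\<exists>T. explored_by P ids E T) \<and>
        (\<exists>t j. terminated_at P ids E t j) \<and>
        (\<forall>t j. terminated_at P ids E t j \<longrightarrow> explored_by P ids E t))"

end

theory Submission imports Defs begin

text \<open>
  Two agents that never share a node learn about the ring only through the rounds in which they are
  blocked.  On the ring of size 3 the adversary keeps the agents apart by blocking, whenever both
  would end up at one node, a single one of them.  So some agent terminates at a time \<open>T\<close> without
  a meeting and without both agents ever being blocked in the same round.  On a ring of size larger
  than \<open>4 T\<close>, with the agents starting far apart, blocking the same agent in the same round
  reproduces both local histories up to time \<open>T\<close>; the agent terminates again, although some node
  has not been visited.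
\<close>

section \<open>Rings whose nodes look alike\<close>

text \<open>Labels and orientations agree at all nodes and for both agents, so no snapshot reveals a
  position or the size.\<close>

definition uniform_ring :: "nat \<Rightarrow> (agent \<Rightarrow> nat) \<Rightarrow> (nat \<Rightarrow> nat option) \<Rightarrow> scenario" where
  "uniform_ring n s m =
     \<lparr> ring_size = n, label_of = (\<lambda>_. case_side 0 1), start = s,
       orient = (\<lambda>_ _. case_side Left Right), missing = m, winner = (\<lambda>_. A) \<rparr>"

definition blocked ::
  "'s protocol \<Rightarrow> (agent \<Rightarrow> nat) \<Rightarrow> scenario \<Rightarrow> nat \<Rightarrow> 's config \<Rightarrow> agent \<Rightarrow> bool" where
  "blocked P ids E t c j \<longleftrightarrow>
     (\<exists>p. wants P ids E c j = Some p \<and>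
          missing E t = Some (edge_of (ring_size E) (node (c j)) p))"

text \<open>The node is left out on purpose: agents cannot perceive it, and the two states may
  belong to rings of different sizes.\<close>

definition same_local :: "'s agent_state \<Rightarrow> 's agent_state \<Rightarrow> bool" where
  "same_local x y \<longleftrightarrow> place x = place y \<and> mem x = mem y \<and> moved x = moved y"

lemma uniform_ring_simps [simp]:
  "ring_size (uniform_ring n s m) = n"
  "start (uniform_ring n s m) = s"
  "missing (uniform_ring n s m) = m"
  "label_of (uniform_ring n s m) = (\<lambda>_. case_side 0 1)"
  "orient (uniform_ring n s m) = (\<lambda>_ _. case_side Left Right)"
  "winner (uniform_ring n s m) = (\<lambda>_. A)"
  "side_of (uniform_ring n s m) j i = case_dir Minus Plus"
  by (auto simp: uniform_ring_def side_of_def fun_eq_iff split: dir.splits)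

lemma valid_uniform_ring:
  assumes "3 \<le> n" "\<And>j. s j < n" "\<And>t e. m t = Some e \<Longrightarrow> e < n"
  shows "valid_scenario (uniform_ring n s m)"
  using assms by (auto simp: valid_scenario_def uniform_ring_def)

lemma common_chirality_uniform_ring: "common_chirality (uniform_ring n s m)"
  by (simp add: common_chirality_def uniform_ring_def)

section \<open>Adaptive choice of the missing edge\<close>

lemma decide_uniform_ring_missing:
  fixes P :: "'s protocol"
  shows "decide P ids (uniform_ring n s m) = decide P ids (uniform_ring n s m')"
proof -
  \<comment> \<open>Missing edges act only in the Move phase; a snapshot, hence a decision, does not
    depend on them.\<close>
  have "look (uniform_ring n s m) = (look (uniform_ring n s m') :: 's config \<Rightarrow> _)"
    by (intro ext) (simp add: look_def Let_def)
  then show ?thesis by (intro ext) (simp add: decide_def)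
qed

lemma wants_uniform_ring_missing:
  "wants P ids (uniform_ring n s m) = wants P ids (uniform_ring n s m')"
  using decide_uniform_ring_missing[of P ids n s m m'] by (intro ext) (simp add: wants_def)

lemma step_uniform_ring_missing:
  assumes "m t = m' t"
  shows "step P ids (uniform_ring n s m) t c = step P ids (uniform_ring n s m') t c"
proof -
  have gets: "gets_port P ids (uniform_ring n s m) t = gets_port P ids (uniform_ring n s m') t"
    using wants_uniform_ring_missing[of P ids n s m m']
    by (intro ext) (simp add: gets_port_def Let_def)
  show ?thesis
    unfolding step_def uniform_ring_simps gets assms wants_uniform_ring_missing[of P ids n s m m']
      decide_uniform_ring_missing[of P ids n s m m'] ..
qed

text \<open>Missing-edge sequences are oblivious, but they can follow any adaptive strategy.\<close>

lemma adaptive_adversary: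
  fixes f :: "nat \<Rightarrow> 's config \<Rightarrow> nat option"
  obtains m where "\<And>t. m t = f t (run P ids (uniform_ring n s m) t)"
proof -
  \<comment> \<open>The run is built before its edge sequence: round \<open>t\<close> uses the
    constant sequence with value \<open>f t c\<close>, which suffices because a step reads only the
    edge missing in its own round.\<close>
  define c where "c = rec_nat (run P ids (uniform_ring n s (\<lambda>_. None)) 0)
    (\<lambda>t c. step P ids (uniform_ring n s (\<lambda>_. f t c)) t c)"
  define m where "m = (\<lambda>t. f t (c t))"
  have "run P ids (uniform_ring n s m) t = c t" for t
  proof (induction t)
    case 0
    show ?case by (simp add: c_def)
  next
    case (Suc t)
    have "step P ids (uniform_ring n s m) t (c t)
        = step P ids (uniform_ring n s (\<lambda>_. f t (c t))) t (c t)"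
      by (rule step_uniform_ring_missing) (simp add: m_def)
    with Suc show ?case by (simp add: c_def)
  qed
  then show ?thesis by (intro that[of m]) (simp add: m_def)
qed

section \<open>Local dynamics of agents at distinct nodes\<close>

lemma edge_of_less: "i < n \<Longrightarrow> edge_of n i p < n"
  by (cases p) auto

lemma neighbour_less: "0 < n \<Longrightarrow> neighbour n i p < n"
  by (cases p) auto

lemma node_run_less:
  assumes "\<And>j. start E j < ring_size E"
  shows "node (run P ids E t j) < ring_size E"
proof (induction t arbitrary: j)
  case 0
  show ?case using assms by simp
next
  case (Suc t)
  have "0 < ring_size E" using assms[of A] by simp
  with Suc show ?case
    by (auto simp: step_def Let_def neighbour_less split: option.split)
qed

text \<open>Agents at different nodes never compete for a port, so the missing edge alone decides
  whether a move succeeds.\<close>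

lemma step_apart:
  assumes "node (c A) \<noteq> node (c B)"
  shows "step P ids E t c j =
    (let i = node (c j); s = fst (decide P ids E c j) in
     case wants P ids E c j of
       None \<Rightarrow> (c j)\<lparr>mem := s\<rparr>
     | Some p \<Rightarrow>
         if blocked P ids E t c j then \<lparr>node = i, place = Port p, mem = s, moved = False\<rparr>
         else \<lparr>node = neighbour (ring_size E) i p, place = Interior, mem = s, moved = True\<rparr>)"
proof -
  have "gets_port P ids E t c j p" for p
    using assms by (cases j) (auto simp: gets_port_def)
  then show ?thesis
    by (simp add: step_def blocked_def Let_def split: option.split)
qed

lemma node_step_apart:
  assumes "node (c A) \<noteq> node (c B)"
  shows "node (step P ids E t c j) =
    (case wants P ids E c j of
       None \<Rightarrow> node (c j)
     | Some p \<Rightarrow> if blocked P ids E t c j then node (c j)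
                 else neighbour (ring_size E) (node (c j)) p)"
  unfolding step_apart[OF assms] by (simp add: Let_def split: option.split)

text \<open>The other agent is out of sight and all nodes look alike, so the snapshot is determined
  by the agent's own place, whatever the sizes, starts and missing edges.\<close>

lemma decide_local:
  assumes "node (c A) \<noteq> node (c B)" "node (c' A) \<noteq> node (c' B)" "same_local (c j) (c' j)"
  shows "decide P ids (uniform_ring n s m) c j = decide P ids (uniform_ring n' s' m') c' j"
proof -
  have "look (uniform_ring n s m) c j = look (uniform_ring n' s' m') c' j"
    using assms by (cases j) (auto simp: look_def same_local_def Let_def)
  then show ?thesis
    using assms(3) by (simp add: decide_def same_local_def)
qed

lemma wants_local:
  assumes "node (c A) \<noteq> node (c B)" "node (c' A) \<noteq> node (c' B)" "same_local (c j) (c' j)"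
  shows "wants P ids (uniform_ring n s m) c j = wants P ids (uniform_ring n' s' m') c' j"
  using decide_local[OF assms, of P ids n s m n' s' m'] by (simp add: wants_def)

text \<open>For an agent that sees nobody, being blocked or not is the only outside influence on its
  local state in a round.\<close>

lemma step_local:
  fixes P :: "'s protocol"
  assumes "node (c A) \<noteq> node (c B)" "node (c' A) \<noteq> node (c' B)" "same_local (c j) (c' j)"
    and "blocked P ids (uniform_ring n s m) t c j = blocked P ids (uniform_ring n' s' m') t c' j"
  shows "same_local (step P ids (uniform_ring n s m) t c j)
                    (step P ids (uniform_ring n' s' m') t c' j)"
  using assms(3,4) decide_local[OF assms(1-3), of P ids n s m n' s' m']
    wants_local[OF assms(1-3), of P ids n s m n' s' m']
  by (auto simp: step_apart[OF assms(1)] step_apart[OF assms(2)] same_local_def Let_def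
      split: option.split)

section \<open>Keeping the agents apart on the ring of size 3\<close>

definition target ::
  "'s protocol \<Rightarrow> (agent \<Rightarrow> nat) \<Rightarrow> scenario \<Rightarrow> 's config \<Rightarrow> agent \<Rightarrow> nat" where
  "target P ids E c j =
     (case wants P ids E c j of
        None \<Rightarrow> node (c j) | Some p \<Rightarrow> neighbour (ring_size E) (node (c j)) p)"

definition wanted_edge ::
  "'s protocol \<Rightarrow> (agent \<Rightarrow> nat) \<Rightarrow> scenario \<Rightarrow> 's config \<Rightarrow> agent \<Rightarrow> nat option" where
  "wanted_edge P ids E c j = map_option (edge_of (ring_size E) (node (c j))) (wants P ids E c j)"

lemma wanted_edge_less:
  assumes "wanted_edge P ids E c j = Some e" "node (c j) < ring_size E"
  shows "e < ring_size E"
  using assms by (auto simp: wanted_edge_def edge_of_less)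

definition separating_edge ::
  "'s protocol \<Rightarrow> (agent \<Rightarrow> nat) \<Rightarrow> scenario \<Rightarrow> 's config \<Rightarrow> nat option" where
  "separating_edge P ids E c =
     (if target P ids E c A \<noteq> target P ids E c B then None
      else if wants P ids E c A \<noteq> None then wanted_edge P ids E c A
      else wanted_edge P ids E c B)"

text \<open>If both agents head for a common third node of the triangle, they use different edges,
  so stopping one lets the other through. If one heads for the node of a resting one, stopping it
  keeps both in place. If the targets differ nothing is removed; swapping over one edge is no
  meeting.\<close>

lemma separating_step:
  assumes size: "ring_size E = 3"
    and nodes: "node (c A) < 3" "node (c B) < 3" "node (c A) \<noteq> node (c B)"
    and missing: "missing E t = separating_edge P ids E c"
  shows "node (step P ids E t c A) \<noteq> node (step P ids E t c B)"
    and "\<not> (blocked P ids E t c A \<and> blocked P ids E t c B)"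
proof -
  have node3: "i = 0 \<or> i = 1 \<or> i = 2" if "i < 3" for i :: nat
    using that by auto
  have want3: "w = None \<or> w = Some Minus \<or> w = Some Plus" for w
    by (metis option.exhaust side.exhaust)
  note defs = node_step_apart[OF nodes(3)] blocked_def missing separating_edge_def target_def
    wanted_edge_def size
  \<comment> \<open>A finite check: three positions and three choices for each agent.\<close>
  show "node (step P ids E t c A) \<noteq> node (step P ids E t c B)"
    using node3[OF nodes(1)] node3[OF nodes(2)] nodes(3)
      want3[of "wants P ids E c A"] want3[of "wants P ids E c B"]
    by (elim disjE) (simp_all add: defs)
  show "\<not> (blocked P ids E t c A \<and> blocked P ids E t c B)"
    using node3[OF nodes(1)] node3[OF nodes(2)] nodes(3)
      want3[of "wants P ids E c A"] want3[of "wants P ids E c B"]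
    by (elim disjE) (simp_all add: defs)
qed

lemma separated_run:
  fixes P :: "'s protocol"
  obtains s m where
    "valid_scenario (uniform_ring 3 s m)"
    "\<And>t. node (run P ids (uniform_ring 3 s m) t A) \<noteq> node (run P ids (uniform_ring 3 s m) t B)"
    "\<And>t. \<not> (blocked P ids (uniform_ring 3 s m) t (run P ids (uniform_ring 3 s m) t) A \<and>
             blocked P ids (uniform_ring 3 s m) t (run P ids (uniform_ring 3 s m) t) B)"
proof -
  define s :: "agent \<Rightarrow> nat" where "s = case_agent 0 1"
  have s: "s j < 3" for j by (cases j) (auto simp: s_def)
  \<comment> \<open>The strategy is evaluated on the ring with no edge missing, as \<open>m\<close>
    is only being constructed; \<open>miss\<close> transfers it to \<open>E\<close>, since the
    wanted ports do not depend on missing edges.\<close>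
  obtain m where m: "\<And>t. m t = separating_edge P ids (uniform_ring 3 s (\<lambda>_. None))
                              (run P ids (uniform_ring 3 s m) t)"
    using adaptive_adversary[of "\<lambda>_. separating_edge P ids (uniform_ring 3 s (\<lambda>_. None))" P ids 3 s]
    by blast
  define E where "E = uniform_ring 3 s m"
  have size: "ring_size E = 3" by (simp add: E_def)
  have less: "node (run P ids E t j) < 3" for t j
    using node_run_less[of E P ids t j] s by (simp add: E_def)
  have miss: "missing E t = separating_edge P ids E (run P ids E t)" for t
    unfolding E_def uniform_ring_simps m[of t]
    unfolding separating_edge_def target_def wanted_edge_def uniform_ring_simps
      wants_uniform_ring_missing[of P ids 3 s m "\<lambda>_. None"] ..
  have apart: "node (run P ids E t A) \<noteq> node (run P ids E t B)" for t
  proof (induction t)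
    case 0
    show ?case by (simp add: E_def s_def)
  next
    case (Suc t)
    show ?case using separating_step(1)[OF size less less Suc miss] by simp
  qed
  have "valid_scenario E"
    unfolding E_def
  proof (rule valid_uniform_ring)
    fix t e assume "m t = Some e"
    then have "separating_edge P ids E (run P ids E t) = Some e"
      using miss[of t] by (simp add: E_def)
    then show "e < 3"
      using less[of t] wanted_edge_less[of P ids E "run P ids E t" _ e]
      by (auto simp: separating_edge_def size split: if_splits)
  qed (use s in auto)
  then show ?thesis
    using that apart separating_step(2)[OF size less less apart miss] unfolding E_def by blast
qed

section \<open>Replaying local histories on a long ring\<close>

text \<open>An agent drifts at most \<open>T\<close> from its start in \<open>T\<close> rounds, so A
  stays within 1 to 2T+1 and B within 2T+5 to 4T+5. With size 4T+10 nobody reaches node 0 or wraps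
  around, and the agents never want the same edge.\<close>

lemma long_ring_replay:
  fixes P :: "'s protocol" and T n :: nat
  defines "s \<equiv> case_agent (T + 1) (3 * T + 5)" and "n \<equiv> 4 * T + 10"
  assumes apart: "\<And>t. node (run P ids (uniform_ring n' s' m') t A)
                      \<noteq> node (run P ids (uniform_ring n' s' m') t B)"
    and one: "\<And>t. \<not> (blocked P ids (uniform_ring n' s' m') t (run P ids (uniform_ring n' s' m') t) A \<and>
                     blocked P ids (uniform_ring n' s' m') t (run P ids (uniform_ring n' s' m') t) B)"
  obtains m where
    "valid_scenario (uniform_ring n s m)"
    "\<And>t j. t \<le> T \<Longrightarrow> same_local (run P ids (uniform_ring n' s' m') t j)
                               (run P ids (uniform_ring n s m) t j)"
    "\<And>t j. t \<le> T \<Longrightarrow> 0 < node (run P ids (uniform_ring n s m) t j)"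
proof -
  define E' where "E' = uniform_ring n' s' m'"
  define c' where "c' = run P ids E'"
  define F where "F = uniform_ring n s (\<lambda>_. None)"
  \<comment> \<open>The edge removed is the one wanted by the agent that is blocked in the given run
    in the same round; by \<open>one\<close>, preferring A neglects nobody.\<close>
  define f where "f = (\<lambda>t c. if blocked P ids E' t (c' t) A then wanted_edge P ids F c A
    else if blocked P ids E' t (c' t) B then wanted_edge P ids F c B else None)"
  obtain m where m: "\<And>t. m t = f t (run P ids (uniform_ring n s m) t)"
    using adaptive_adversary[of f P ids n s] by blast
  define E where "E = uniform_ring n s m"
  define c where "c = run P ids E"
  have s: "s j < n" for j by (cases j) (auto simp: s_def n_def)
  have wanted: "wanted_edge P ids F = wanted_edge P ids E"
    by (intro ext) (simp add: wanted_edge_def E_def F_def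
        wants_uniform_ring_missing[of P ids n s "\<lambda>_. None" m])
  have miss: "missing E t = (if blocked P ids E' t (c' t) A then wanted_edge P ids E (c t) A
    else if blocked P ids E' t (c' t) B then wanted_edge P ids E (c t) B else None)" for t
  proof -
    have "missing E t = f t (c t)" using m[of t] by (simp add: E_def c_def)
    then show ?thesis by (simp add: f_def wanted)
  qed
  have less: "node (c t j) < n" for t j
    using node_run_less[of E P ids t j] s by (simp add: E_def c_def)
  \<comment> \<open>The drift bound is written with sums because subtraction on naturals
    truncates.\<close>
  have inv: "t \<le> T \<Longrightarrow> (\<forall>j. same_local (c' t j) (c t j) \<and>
      s j \<le> node (c t j) + t \<and> node (c t j) \<le> s j + t)" for t
  proof (induction t)
    case 0
    show ?case by (auto simp: c_def c'_def E_def E'_def same_local_def)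
  next
    case (Suc t)
    then have t: "t < T"
      and loc: "\<And>j. same_local (c' t j) (c t j)"
      and near: "\<And>j. s j \<le> node (c t j) + t" "\<And>j. node (c t j) \<le> s j + t"
      by auto
    have bounds: "T + 1 \<le> node (c t A) + t" "node (c t A) \<le> T + 1 + t"
      "3 * T + 5 \<le> node (c t B) + t" "node (c t B) \<le> 3 * T + 5 + t"
      using near[of A] near[of B] by (auto simp: s_def)
    have ap: "node (c t A) \<noteq> node (c t B)" using bounds t by linarith
    have ap': "node (c' t A) \<noteq> node (c' t B)" using apart[of t] by (simp add: c'_def E'_def)
    \<comment> \<open>Both agents are far from the seam of the ring, so reduction modulo
      \<open>n\<close> has no effect.\<close>
    have minus: "(node (c t j) + n - 1) mod n = node (c t j) - 1" "0 < node (c t j)"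
      and plus: "(node (c t j) + 1) mod n = node (c t j) + 1" for j
    proof -
      have b: "0 < node (c t j) \<and> node (c t j) + 1 < n"
        using bounds t by (cases j) (auto simp: n_def)
      then have "node (c t j) + n - 1 = (node (c t j) - 1) + n" by simp
      then show "(node (c t j) + n - 1) mod n = node (c t j) - 1"
        using b by (metis mod_add_self2 mod_less less_imp_diff_less add_lessD1)
      show "0 < node (c t j)" "(node (c t j) + 1) mod n = node (c t j) + 1"
        using b by auto
    qed
    \<comment> \<open>Every edge A could want lies below every edge B could want, so a single
      missing edge cannot block both.\<close>
    have edges: "edge_of n (node (c t A)) p < edge_of n (node (c t B)) q" for p q
      using bounds t minus[of A] minus[of B] by (cases p; cases q) auto
    have wants: "wants P ids E' (c' t) j = wants P ids E (c t) j" for j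
      unfolding E_def E'_def by (rule wants_local[OF ap' ap loc])
    have edges_ne: "edge_of n (node (c t A)) p \<noteq> edge_of n (node (c t B)) q" for p q
      using edges[of p q] by simp
    have size: "ring_size E = n" by (simp add: E_def)
    have "blocked P ids E' t (c' t) A = blocked P ids E t (c t) A \<and>
          blocked P ids E' t (c' t) B = blocked P ids E t (c t) B"
    proof -
      consider "blocked P ids E' t (c' t) A" "\<not> blocked P ids E' t (c' t) B"
        | "\<not> blocked P ids E' t (c' t) A" "blocked P ids E' t (c' t) B"
        | "\<not> blocked P ids E' t (c' t) A" "\<not> blocked P ids E' t (c' t) B"
        using one[of t] unfolding E'_def c'_def by blast
      then show ?thesis
      proof cases
        case 1
        \<comment> \<open>Being blocked in the given run entails wanting a port, and the same port
          is wanted here, so there is an edge to remove.\<close>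
        then obtain p where p: "wants P ids E (c t) A = Some p"
          unfolding blocked_def wants by blast
        then have e: "missing E t = Some (edge_of n (node (c t A)) p)"
          using 1 by (simp add: miss wanted_edge_def size)
        have "blocked P ids E t (c t) A" "\<not> blocked P ids E t (c t) B"
          by (simp_all add: blocked_def e p size edges_ne)
        with 1 show ?thesis by simp
      next
        case 2
        then obtain p where p: "wants P ids E (c t) B = Some p"
          unfolding blocked_def wants by blast
        then have e: "missing E t = Some (edge_of n (node (c t B)) p)"
          using 2 by (simp add: miss wanted_edge_def size)
        have "blocked P ids E t (c t) B" "\<not> blocked P ids E t (c t) A"
          by (simp_all add: blocked_def e p size edges_ne[symmetric])
        with 2 show ?thesis by simp
      next
        case 3
        then have "missing E t = None" by (simp add: miss)
        then have "\<not> blocked P ids E t (c t) A" "\<not> blocked P ids E t (c t) B"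
          by (simp_all add: blocked_def)
        with 3 show ?thesis by simp
      qed
    qed
    then have blocked: "blocked P ids E' t (c' t) j = blocked P ids E t (c t) j" for j
      by (cases j) simp_all
    show ?case
    proof (intro allI conjI)
      fix j
      show "same_local (c' (Suc t) j) (c (Suc t) j)"
        using step_local[OF ap' ap loc[of j], of P ids n' s' m' t n s m] blocked[of j]
        by (simp add: c_def c'_def E_def E'_def)
      have "node (c (Suc t) j) = (case wants P ids E (c t) j of None \<Rightarrow> node (c t j)
          | Some p \<Rightarrow> if blocked P ids E t (c t) j then node (c t j)
                      else neighbour n (node (c t j)) p)"
        using node_step_apart[of "c t" P ids E t j, OF ap] unfolding size by (simp add: c_def)
      then have "node (c (Suc t) j) \<le> node (c t j) + 1 \<and> node (c t j) \<le> node (c (Suc t) j) + 1"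
        using minus[of j] plus[of j]
        by (cases "wants P ids E (c t) j"; cases "the (wants P ids E (c t) j)") auto
      with near[of j] show "s j \<le> node (c (Suc t) j) + Suc t" "node (c (Suc t) j) \<le> s j + Suc t"
        by auto
    qed
  qed
  show ?thesis
  proof (rule that[of m, folded E_def, folded E'_def c_def c'_def])
    show "valid_scenario E"
      unfolding E_def
    proof (rule valid_uniform_ring)
      show "3 \<le> n" by (simp add: n_def)
      fix t e assume "m t = Some e"
      then have "missing E t = Some e" by (simp add: E_def)
      then obtain j where "wanted_edge P ids E (c t) j = Some e"
        by (auto simp: miss split: if_splits)
      then show "e < n"
        using wanted_edge_less[of P ids E "c t" j e] less[of t j] by (simp add: E_def)
    qed (rule s)
    show "same_local (c' t j) (c t j)" if "t \<le> T" for t j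
      using inv[OF that] by simp
    show "0 < node (c t j)" if "t \<le> T" for t j
    proof -
      \<comment> \<open>Both starts exceed \<open>T\<close>, so a drift of at most \<open>t\<close>
        cannot reach node 0.\<close>
      have "t < s j" using that by (cases j) (auto simp: s_def)
      then show ?thesis using inv[OF that] by (auto dest: spec[of _ j])
    qed
  qed
qed

theorem theorem1:
  fixes ids :: "agent \<Rightarrow> nat" and chirality :: bool
  shows "\<not> (\<exists>P :: 's protocol. solves_with_partial_termination chirality ids P)"
proof
  assume "\<exists>P :: 's protocol. solves_with_partial_termination chirality ids P"
  then obtain P :: "'s protocol" where P: "solves_with_partial_termination chirality ids P" by blast
  obtain s' m' where E': "valid_scenario (uniform_ring 3 s' m')"
    and sep: "\<And>t. node (run P ids (uniform_ring 3 s' m') t A)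
                  \<noteq> node (run P ids (uniform_ring 3 s' m') t B)"
      "\<And>t. \<not> (blocked P ids (uniform_ring 3 s' m') t (run P ids (uniform_ring 3 s' m') t) A \<and>
               blocked P ids (uniform_ring 3 s' m') t (run P ids (uniform_ring 3 s' m') t) B)"
    using separated_run[of P ids] by metis
  from P E' obtain T j where term': "terminated_at P ids (uniform_ring 3 s' m') T j"
    unfolding solves_with_partial_termination_def using common_chirality_uniform_ring by blast
  obtain n s m where E: "valid_scenario (uniform_ring n s m)"
    and replay: "\<And>t j. t \<le> T \<Longrightarrow> same_local (run P ids (uniform_ring 3 s' m') t j)
                                             (run P ids (uniform_ring n s m) t j)"
    and pos: "\<And>t j. t \<le> T \<Longrightarrow> 0 < node (run P ids (uniform_ring n s m) t j)"
    using long_ring_replay[OF sep, of T] by metis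
  \<comment> \<open>\<open>terminal\<close> reads only the identifier and the memory, and
    \<open>same_local\<close> preserves the memory.\<close>
  have "terminated_at P ids (uniform_ring n s m) T j"
    using term' replay[of T j] by (simp add: terminated_at_def same_local_def)
  with P E have "explored_by P ids (uniform_ring n s m) T"
    unfolding solves_with_partial_termination_def using common_chirality_uniform_ring by blast
  moreover have "0 < n" using E by (simp add: valid_scenario_def)
  \<comment> \<open>Node 0 is the one that exploration would need but both agents avoid up to time
    \<open>T\<close>.\<close>
  ultimately obtain t i where "t \<le> T" "node (run P ids (uniform_ring n s m) t i) = 0"
    by (auto simp: explored_by_def)
  with pos[of t i] show False by simp
qed

end
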